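(* Let $U, V, W$ be vector spaces over a field $F$ and let $T_1 \colon V \to W$ and $T_2 \colon U \to V$ be linear with outer (resp. inner) inverses $G_1 \colon W \to V$ and $G_2 \colon V \to U$. Let $P = G_1T_1$ and $Q = T_2G_2$. Then $G_2G_1$ is an outer (resp. inner) inverse of $T_1T_2$ if and only if $QP$ (resp. $PQ$) is a projector.
   Context: Vector spaces are arbitrary (possibly infinite-dimensional). For a linear map $T\colon V\to W$, a linear map $G\colon W\to V$ is called an inner inverse of $T$ if $TGT=T$ and an outer inverse of $T$ if $GTG=G$. A projector is an idempotent linear endomorphism. The statement consists of two separate assertions: one for outer inverses (both $G_i$ outer inverses of $T_i$, with $QP$) and one for inner inverses (both $G_i$ inner inverses of $T_i$, with $PQ$). *)

theory Defs
  imports Complex_Main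
begin

text \<open>
  A vector space is a type of class \<open>ab_group_add\<close> together with a scalar multiplication
  satisfying \<^locale>\<open>vector_space\<close>; the predicate \<^term>\<open>Vector_Spaces.linear s1 s2 f\<close>
  includes that \<open>s1\<close> and \<open>s2\<close> are vector spaces. The scalar multiplication of the domain
  of \<open>T\<close> comes first.
\<close>

definition inner_inverse ::
  "('f::field \<Rightarrow> 'v::ab_group_add \<Rightarrow> 'v) \<Rightarrow> ('f \<Rightarrow> 'w::ab_group_add \<Rightarrow> 'w) \<Rightarrow>
    ('v \<Rightarrow> 'w) \<Rightarrow> ('w \<Rightarrow> 'v) \<Rightarrow> bool"
  where "inner_inverse sV sW T G \<longleftrightarrow>
    Vector_Spaces.linear sV sW T \<and> Vector_Spaces.linear sW sV G \<and> T \<circ> G \<circ> T = T"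

definition outer_inverse ::
  "('f::field \<Rightarrow> 'v::ab_group_add \<Rightarrow> 'v) \<Rightarrow> ('f \<Rightarrow> 'w::ab_group_add \<Rightarrow> 'w) \<Rightarrow>
    ('v \<Rightarrow> 'w) \<Rightarrow> ('w \<Rightarrow> 'v) \<Rightarrow> bool"
  where "outer_inverse sV sW T G \<longleftrightarrow>
    Vector_Spaces.linear sV sW T \<and> Vector_Spaces.linear sW sV G \<and> G \<circ> T \<circ> G = G"

definition projector :: "('f::field \<Rightarrow> 'v::ab_group_add \<Rightarrow> 'v) \<Rightarrow> ('v \<Rightarrow> 'v) \<Rightarrow> bool"
  where "projector sV P \<longleftrightarrow> Vector_Spaces.linear sV sV P \<and> P \<circ> P = P"

end

theory Submission
  imports Defs
begin

text \<open>
  Both parts are the same identity between compositions of maps: if \<open>A1 B1 A1 = A1\<close> and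
  \<open>A2 B2 A2 = A2\<close>, multiplying by \<open>B2\<close> on the left and \<open>B1\<close> on the right turns
  \<open>(A2 A1) (B1 B2) (A2 A1) = A2 A1\<close> into idempotency of \<open>(B2 A2) (A1 B1)\<close>, and
  multiplying by \<open>A2\<close> and \<open>A1\<close> undoes this. Outer inverses are the case
  \<open>A = G\<close>, \<open>B = T\<close>; inner inverses the case \<open>A = T\<close>, \<open>B = G\<close> with the indices swapped.
\<close>

lemma comp_regular_iff_idempotent:
  assumes "A1 \<circ> B1 \<circ> A1 = A1" and "A2 \<circ> B2 \<circ> A2 = A2"
  shows "(A2 \<circ> A1) \<circ> (B1 \<circ> B2) \<circ> (A2 \<circ> A1) = A2 \<circ> A1 \<longleftrightarrow>
    ((B2 \<circ> A2) \<circ> (A1 \<circ> B1)) \<circ> ((B2 \<circ> A2) \<circ> (A1 \<circ> B1)) = (B2 \<circ> A2) \<circ> (A1 \<circ> B1)"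
    (is "?M = A2 \<circ> A1 \<longleftrightarrow> ?E \<circ> ?E = ?E")
proof
  assume "?M = A2 \<circ> A1"
  \<comment> \<open>Up to bracketing, the two sides are \<open>?E \<circ> ?E\<close> and
    \<open>?E\<close>.\<close>
  then have "B2 \<circ> ?M \<circ> B1 = B2 \<circ> (A2 \<circ> A1) \<circ> B1"
    by simp
  then show "?E \<circ> ?E = ?E"
    by (simp add: comp_assoc)
next
  assume *: "?E \<circ> ?E = ?E"
  \<comment> \<open>Pointwise, the assumptions can rewrite inside long composites, however these are
    bracketed.\<close>
  have A: "A1 (B1 (A1 x)) = A1 x" "A2 (B2 (A2 y)) = A2 y" for x y
    using assms by (metis comp_apply)+
  \<comment> \<open>The outer factors cancel: \<open>A2 \<circ> B2 \<circ> A2\<close> and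
    \<open>A1 \<circ> B1 \<circ> A1\<close> collapse, leaving \<open>?M\<close> on the left and
    \<open>A2 \<circ> A1\<close> on the right.\<close>
  from * have "A2 \<circ> (?E \<circ> ?E) \<circ> A1 = A2 \<circ> ?E \<circ> A1"
    by simp
  then show "?M = A2 \<circ> A1"
    by (simp add: fun_eq_iff A)
qed

theorem proposition3:
  fixes sU :: "'f::field \<Rightarrow> 'u::ab_group_add \<Rightarrow> 'u"
    and sV :: "'f \<Rightarrow> 'v::ab_group_add \<Rightarrow> 'v"
    and sW :: "'f \<Rightarrow> 'w::ab_group_add \<Rightarrow> 'w"
    and T1 :: "'v \<Rightarrow> 'w" and T2 :: "'u \<Rightarrow> 'v"
    and G1 :: "'w \<Rightarrow> 'v" and G2 :: "'v \<Rightarrow> 'u"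
    and P Q :: "'v \<Rightarrow> 'v"
  assumes "vector_space sU" and "vector_space sV" and "vector_space sW"
    and "Vector_Spaces.linear sV sW T1" and "Vector_Spaces.linear sU sV T2"
    and "P = G1 \<circ> T1" and "Q = T2 \<circ> G2"
  shows "(outer_inverse sV sW T1 G1 \<and> outer_inverse sU sV T2 G2 \<longrightarrow>
           (outer_inverse sU sW (T1 \<circ> T2) (G2 \<circ> G1) \<longleftrightarrow> projector sV (Q \<circ> P))) \<and>
         (inner_inverse sV sW T1 G1 \<and> inner_inverse sU sV T2 G2 \<longrightarrow>
           (inner_inverse sU sW (T1 \<circ> T2) (G2 \<circ> G1) \<longleftrightarrow> projector sV (P \<circ> Q)))"
proof (intro conjI impI)
  assume "outer_inverse sV sW T1 G1 \<and> outer_inverse sU sV T2 G2"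
  then have eqs: "G1 \<circ> T1 \<circ> G1 = G1" "G2 \<circ> T2 \<circ> G2 = G2"
    and lin: "Vector_Spaces.linear sW sV G1" "Vector_Spaces.linear sV sU G2"
    by (auto simp: outer_inverse_def)
  \<comment> \<open>With the linearity clauses settled, both predicates reduce to their composition
    equations.\<close>
  have "Vector_Spaces.linear sV sV ((T2 \<circ> G2) \<circ> (G1 \<circ> T1))" "Vector_Spaces.linear sU sW (T1 \<circ> T2)"
    "Vector_Spaces.linear sW sU (G2 \<circ> G1)"
    using lin assms(4,5) by (blast intro: Vector_Spaces.linear_compose)+
  then show "outer_inverse sU sW (T1 \<circ> T2) (G2 \<circ> G1) \<longleftrightarrow> projector sV (Q \<circ> P)"
    using comp_regular_iff_idempotent[OF eqs]
    by (simp add: outer_inverse_def projector_def assms(6,7))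
next
  assume "inner_inverse sV sW T1 G1 \<and> inner_inverse sU sV T2 G2"
  \<comment> \<open>Listing \<open>T2\<close> first makes \<open>A1 = T2\<close> and
    \<open>A2 = T1\<close>, so the idempotent is \<open>P \<circ> Q\<close> rather than
    \<open>Q \<circ> P\<close>.\<close>
  then have eqs: "T2 \<circ> G2 \<circ> T2 = T2" "T1 \<circ> G1 \<circ> T1 = T1"
    and lin: "Vector_Spaces.linear sW sV G1" "Vector_Spaces.linear sV sU G2"
    by (auto simp: inner_inverse_def)
  have "Vector_Spaces.linear sV sV ((G1 \<circ> T1) \<circ> (T2 \<circ> G2))" "Vector_Spaces.linear sU sW (T1 \<circ> T2)"
    "Vector_Spaces.linear sW sU (G2 \<circ> G1)"
    using lin assms(4,5) by (blast intro: Vector_Spaces.linear_compose)+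
  then show "inner_inverse sU sW (T1 \<circ> T2) (G2 \<circ> G1) \<longleftrightarrow> projector sV (P \<circ> Q)"
    using comp_regular_iff_idempotent[OF eqs]
    by (simp add: inner_inverse_def projector_def assms(6,7))
qed

end
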